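(* For any graphs $G$ and $H$, $$\nu_I(G\odot H)=\begin{cases}|V(G)|\,\nu_I(H) & \text{if } E(H)\ne\emptyset,\\ \alpha(G) & \text{if } E(H)=\emptyset.\end{cases}$$
   Context: All graphs are finite and simple (with nonempty vertex set). A matching $M$ of a graph $G$ is an induced matching if no two distinct edges of $M$ are joined by an edge of $G$; $\nu_I(G)$ denotes the maximum cardinality of an induced matching in $G$. $\alpha(G)$ is the independence number of $G$. For graphs $G$ and $H$ with $V(G)=\{v_1,\ldots,v_n\}$, the corona product $G\odot H$ is obtained from the disjoint union of $G$ and $n$ disjoint copies $H_1,\ldots,H_n$ of $H$ by making $v_i$ adjacent to all vertices of $H_i$ for each $i\in\{1,\ldots,n\}$. *)

theory Defs
  imports "Graph_Theory.Pair_Digraph"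
begin

text \<open>A finite simple graph is a \<open>pair_graph\<close>: a finite, symmetric, loop-free relation, in
  which the undirected edge between \<open>u\<close> and \<open>v\<close> appears as the two arcs \<open>(u, v)\<close> and \<open>(v, u)\<close>.
  That locale admits the null graph.\<close>

definition uedges :: "'a pair_pre_digraph \<Rightarrow> 'a set set" where
  "uedges G = {{u, v} | u v. (u, v) \<in> parcs G}"

definition matching :: "'a pair_pre_digraph \<Rightarrow> 'a set set \<Rightarrow> bool" where
  "matching G M \<longleftrightarrow> M \<subseteq> uedges G \<and> (\<forall>e\<in>M. \<forall>f\<in>M. e \<noteq> f \<longrightarrow> e \<inter> f = {})"

definition induced_matching :: "'a pair_pre_digraph \<Rightarrow> 'a set set \<Rightarrow> bool" where
  "induced_matching G M \<longleftrightarrow> matching G M \<and>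
     (\<forall>e\<in>M. \<forall>f\<in>M. e \<noteq> f \<longrightarrow> \<not> (\<exists>u\<in>e. \<exists>v\<in>f. {u, v} \<in> uedges G))"

definition induced_matching_number :: "'a pair_pre_digraph \<Rightarrow> nat" where
  "induced_matching_number G = Max (card ` {M. induced_matching G M})"

definition independent_set :: "'a pair_pre_digraph \<Rightarrow> 'a set \<Rightarrow> bool" where
  "independent_set G S \<longleftrightarrow> S \<subseteq> pverts G \<and> (\<forall>u\<in>S. \<forall>v\<in>S. {u, v} \<notin> uedges G)"

definition independence_number :: "'a pair_pre_digraph \<Rightarrow> nat" where
  "independence_number G = Max (card ` {S. independent_set G S})"

text \<open>\<open>Inl v\<close> is the vertex \<open>v\<close> of \<open>G\<close>, and \<open>Inr (v, x)\<close> is the vertex \<open>x\<close> in the copy of \<open>H\<close>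
  attached to \<open>v\<close>; the copies are indexed by the vertices of \<open>G\<close> themselves.\<close>

definition corona ::
  "'a pair_pre_digraph \<Rightarrow> 'b pair_pre_digraph \<Rightarrow> ('a + 'a \<times> 'b) pair_pre_digraph" where
  "corona G H = \<lparr>
     pverts = Inl ` pverts G \<union> Inr ` (pverts G \<times> pverts H),
     parcs = {(Inl u, Inl v) | u v. (u, v) \<in> parcs G}
           \<union> {(Inr (v, x), Inr (v, y)) | v x y. v \<in> pverts G \<and> (x, y) \<in> parcs H}
           \<union> {(Inl v, Inr (v, x)) | v x. v \<in> pverts G \<and> x \<in> pverts H}
           \<union> {(Inr (v, x), Inl v) | v x. v \<in> pverts G \<and> x \<in> pverts H}\<rparr>"

lemma pair_graph_corona:
  assumes "pair_graph G" "pair_graph H"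
  shows "pair_graph (corona G H)"
proof -
  interpret G: pair_graph G by fact
  interpret H: pair_graph H by fact
  let ?V = "pverts (corona G H)"
  have sub: "parcs (corona G H) \<subseteq> ?V \<times> ?V"
    by (auto simp: corona_def dest: G.wellformed' H.wellformed')
  have fin: "finite ?V"
    by (simp add: corona_def G.pair_finite_verts H.pair_finite_verts)
  have "finite (parcs (corona G H))"
    using sub fin by (meson finite_SigmaI finite_subset)
  moreover have "symmetric (with_proj (corona G H))"
    by (auto simp: symmetric_def corona_def intro!: symI
        dest: G.arcs_symmetric H.arcs_symmetric)
  moreover have "fst e \<noteq> snd e" if "e \<in> parcs (corona G H)" for e
    using that by (auto simp: corona_def dest: G.no_loops' H.no_loops')
  ultimately show ?thesis
    using sub fin by unfold_locales auto
qed

text \<open>The maxima above range over finite nonempty sets.\<close>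

lemma finite_induced_matchings:
  assumes "pair_graph G"
  shows "finite {M. induced_matching G M}" "{M. induced_matching G M} \<noteq> {}"
proof -
  interpret pair_graph G by fact
  have "uedges G \<subseteq> Pow (pverts G)"
    by (auto simp: uedges_def dest: wellformed')
  then have "finite (uedges G)"
    using pair_finite_verts by (meson finite_Pow_iff finite_subset)
  moreover have "{M. induced_matching G M} \<subseteq> Pow (uedges G)"
    by (auto simp: induced_matching_def matching_def)
  ultimately show "finite {M. induced_matching G M}"
    by (meson finite_Pow_iff finite_subset)
  have "induced_matching G {}"
    by (simp add: induced_matching_def matching_def)
  then show "{M. induced_matching G M} \<noteq> {}" by blast
qed

lemma finite_independent_sets:
  assumes "pair_graph G"
  shows "finite {S. independent_set G S}" "{S. independent_set G S} \<noteq> {}"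
proof -
  interpret pair_graph G by fact
  have "{S. independent_set G S} \<subseteq> Pow (pverts G)"
    by (auto simp: independent_set_def)
  then show "finite {S. independent_set G S}"
    using pair_finite_verts by (meson finite_Pow_iff finite_subset)
  have "independent_set G {}"
    by (simp add: independent_set_def)
  then show "{S. independent_set G S} \<noteq> {}" by blast
qed

end

theory Submission
  imports Defs
begin

text \<open>An edge of the corona lying over a vertex \<open>v\<close> of \<open>G\<close> means an edge that meets \<open>v\<close> or its copy
  of \<open>H\<close>. If an induced matching contains an edge covering \<open>v\<close> itself, then that is its only edge
  over \<open>v\<close>, since \<open>v\<close> is adjacent to its whole copy; otherwise its edges over \<open>v\<close> form an induced
  matching of the copy. So if \<open>H\<close> has an edge, at most \<open>\<nu>\<^sub>I(H)\<close> edges lie over each \<open>v\<close>, and optimal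
  matchings in all copies attain this. If \<open>H\<close> has no edge, every matching edge covers a
  vertex of \<open>G\<close>; one such vertex per edge gives an independent set, and conversely every
  independent set gives an induced matching of pendant edges.\<close>

text \<open>An edge may come from either of its two arcs; symmetry of the arc relation makes them
  interchangeable.\<close>

lemma (in pair_graph) uedges_iff: "{u, v} \<in> uedges G \<longleftrightarrow> (u, v) \<in> parcs G"
  by (auto simp: uedges_def doubleton_eq_iff dest: arcs_symmetric)

lemma (in pair_graph) induced_matching_iff:
  "induced_matching G M \<longleftrightarrow> M \<subseteq> uedges G \<and>
     (\<forall>e\<in>M. \<forall>f\<in>M. e \<noteq> f \<longrightarrow> (\<forall>u\<in>e. \<forall>v\<in>f. u \<noteq> v \<and> (u, v) \<notin> parcs G))"
  unfolding induced_matching_def matching_def uedges_iff by blast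

lemma (in pair_graph) induced_matching_uedge:
  "induced_matching G M \<Longrightarrow> e \<in> M \<Longrightarrow> e \<in> uedges G"
  unfolding induced_matching_iff by blast

lemma (in pair_graph) induced_matching_separated:
  assumes "induced_matching G M" "e \<in> M" "f \<in> M" "e \<noteq> f" "u \<in> e" "v \<in> f"
  shows "u \<noteq> v \<and> (u, v) \<notin> parcs G"
  using assms unfolding induced_matching_iff by blast

lemma (in pair_graph) independent_set_iff:
  "independent_set G S \<longleftrightarrow> S \<subseteq> pverts G \<and> (\<forall>u\<in>S. \<forall>v\<in>S. (u, v) \<notin> parcs G)"
  unfolding independent_set_def uedges_iff ..

lemma (in pair_graph) finite_induced_matching:
  assumes "induced_matching G M"
  shows "finite M"
proof -
  have "uedges G \<subseteq> Pow (pverts G)"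
    by (auto simp: uedges_def dest: wellformed')
  moreover have "M \<subseteq> uedges G"
    using assms by (simp add: induced_matching_iff)
  ultimately show ?thesis
    using pair_finite_verts by (meson finite_Pow_iff finite_subset)
qed

lemma card_le_induced_matching_number:
  assumes "pair_graph G" "induced_matching G M"
  shows "card M \<le> induced_matching_number G"
  unfolding induced_matching_number_def
  using finite_induced_matchings[OF assms(1)] assms(2) by (intro Max_ge) auto

lemma obtain_maximum_induced_matching:
  assumes "pair_graph G"
  obtains M where "induced_matching G M" "card M = induced_matching_number G"
proof -
  have "induced_matching_number G \<in> card ` {M. induced_matching G M}"
    unfolding induced_matching_number_def
    using finite_induced_matchings[OF assms] by (intro Max_in) auto
  then show thesis using that by auto
qed

lemma card_le_independence_number:
  assumes "pair_graph G" "independent_set G S"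
  shows "card S \<le> independence_number G"
  unfolding independence_number_def
  using finite_independent_sets[OF assms(1)] assms(2) by (intro Max_ge) auto

lemma obtain_maximum_independent_set:
  assumes "pair_graph G"
  obtains S where "independent_set G S" "card S = independence_number G"
proof -
  have "independence_number G \<in> card ` {S. independent_set G S}"
    unfolding independence_number_def
    using finite_independent_sets[OF assms] by (intro Max_in) auto
  then show thesis using that by auto
qed

text \<open>A single edge is vacuously an induced matching. This pays for the one edge over
  \<open>v\<close> when \<open>v\<close> itself is matched.\<close>

lemma induced_matching_number_pos:
  assumes "pair_graph G" "uedges G \<noteq> {}"
  shows "1 \<le> induced_matching_number G"
proof -
  obtain e where "e \<in> uedges G" using assms(2) by blast
  then have "induced_matching G {e}"
    by (simp add: induced_matching_def matching_def)
  from card_le_induced_matching_number[OF assms(1) this] show ?thesis by simp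
qed

lemma parcs_corona_simps [simp]:
  "(Inl u, Inl v) \<in> parcs (corona G H) \<longleftrightarrow> (u, v) \<in> parcs G"
  "(Inl u, Inr (v, x)) \<in> parcs (corona G H) \<longleftrightarrow> u = v \<and> v \<in> pverts G \<and> x \<in> pverts H"
  "(Inr (v, x), Inl u) \<in> parcs (corona G H) \<longleftrightarrow> u = v \<and> v \<in> pverts G \<and> x \<in> pverts H"
  "(Inr (u, x), Inr (v, y)) \<in> parcs (corona G H) \<longleftrightarrow> u = v \<and> v \<in> pverts G \<and> (x, y) \<in> parcs H"
  by (auto simp: corona_def)

text \<open>Four kinds of arcs yield three kinds of edges, since the two orientations of a spoke
  give the same set.\<close>

lemma uedges_corona_cases:
  assumes "e \<in> uedges (corona G H)"
  obtains (base) u v where "(u, v) \<in> parcs G" "e = {Inl u, Inl v}"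
  | (spoke) v x where "v \<in> pverts G" "x \<in> pverts H" "e = {Inl v, Inr (v, x)}"
  | (copy) v x y where "v \<in> pverts G" "(x, y) \<in> parcs H" "e = {Inr (v, x), Inr (v, y)}"
  using assms by (auto simp: uedges_def corona_def insert_commute)

text \<open>Here \<open>x\<close> ranges over the whole type; edges of the corona contain only its
  vertices, so intersections with them are unaffected.\<close>

abbreviation fibre :: "'a \<Rightarrow> ('a + 'a \<times> 'b) set" where
  "fibre v \<equiv> insert (Inl v) (range (\<lambda>x. Inr (v, x)))"

locale corona_graphs = G: pair_graph G + H: pair_graph H
  for G :: "'a pair_pre_digraph" and H :: "'b pair_pre_digraph"
begin

sublocale C: pair_graph "corona G H"
  by (rule pair_graph_corona) unfold_locales

lemma uedge_meets_fibre:
  assumes "e \<in> uedges (corona G H)"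
  shows "\<exists>v\<in>pverts G. e \<inter> fibre v \<noteq> {}"
  using assms by (cases rule: uedges_corona_cases) (auto dest: G.wellformed')

lemma card_over_vertex_le:
  assumes M: "induced_matching (corona G H) M" and v: "v \<in> pverts G" and H: "uedges H \<noteq> {}"
  shows "card {e \<in> M. e \<inter> fibre v \<noteq> {}} \<le> induced_matching_number H"
proof (cases "\<exists>e\<in>M. Inl v \<in> e")
  case True
  then obtain e where e: "e \<in> M" "Inl v \<in> e" by blast
  have "f = e" if f: "f \<in> M" "f \<inter> fibre v \<noteq> {}" for f
  proof (rule ccontr)
    assume "f \<noteq> e"
    then have sep: "\<forall>w\<in>f. Inl v \<noteq> w \<and> (Inl v, w) \<notin> parcs (corona G H)"
      using e f C.induced_matching_separated[OF M] by metis
    then obtain x where x: "Inr (v, x) \<in> f" using f by auto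
    have "f \<in> uedges (corona G H)" using C.induced_matching_uedge M f by blast
    \<comment> \<open>Being an endpoint of an edge, \<open>x\<close> is a true vertex of
      \<open>H\<close>, so \<open>Inr (v, x)\<close> is adjacent to \<open>Inl v\<close>, against
      \<open>sep\<close>.\<close>
    then have "x \<in> pverts H"
      using x by (cases rule: uedges_corona_cases) (auto dest: H.wellformed')
    then show False using sep x v by auto
  qed
  then have "{e \<in> M. e \<inter> fibre v \<noteq> {}} \<subseteq> {e}" by blast
  then have "card {e \<in> M. e \<inter> fibre v \<noteq> {}} \<le> card {e}" by (intro card_mono) auto
  \<comment> \<open>Here \<open>H\<close> must have an edge: otherwise the right-hand side would be
    0.\<close>
  also have "\<dots> \<le> induced_matching_number H"
    using induced_matching_number_pos[OF H.pair_graph_axioms H] by simp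
  finally show ?thesis .
next
  case False
  let ?i = "\<lambda>x. Inr (v, x) :: 'a + 'a \<times> 'b"
  \<comment> \<open>The pullback of \<open>M\<close> along the embedding of \<open>H\<close> as the
    copy at \<open>v\<close>. As no edge of \<open>M\<close> covers \<open>Inl v\<close>, every edge
    over \<open>v\<close> is the image of one in \<open>N\<close>.\<close>
  define N where "N = {e \<in> uedges H. ?i ` e \<in> M}"
  have inj: "inj ?i" by (auto intro: injI)
  have "{e \<in> M. e \<inter> fibre v \<noteq> {}} \<subseteq> (`) ?i ` N"
  proof
    fix e assume e: "e \<in> {e \<in> M. e \<inter> fibre v \<noteq> {}}"
    then have "e \<in> uedges (corona G H)" using C.induced_matching_uedge M by blast
    then obtain x y where xy: "(x, y) \<in> parcs H" "e = ?i ` {x, y}"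
      using e False by (cases rule: uedges_corona_cases) auto
    then have "{x, y} \<in> N" using e by (simp add: N_def H.uedges_iff)
    then show "e \<in> (`) ?i ` N" using xy by blast
  qed
  moreover have N: "induced_matching H N"
    unfolding H.induced_matching_iff
  proof (intro conjI ballI impI)
    show "N \<subseteq> uedges H" by (auto simp: N_def)
    fix e f x y assume *: "e \<in> N" "f \<in> N" "e \<noteq> f" "x \<in> e" "y \<in> f"
    then have "?i ` e \<in> M" "?i ` f \<in> M" "?i ` e \<noteq> ?i ` f"
      by (auto simp: N_def inj_image_eq_iff[OF inj])
    then have "?i x \<noteq> ?i y \<and> (?i x, ?i y) \<notin> parcs (corona G H)"
      using * by (intro C.induced_matching_separated[OF M]) auto
    then show "x \<noteq> y" "(x, y) \<notin> parcs H" using v by auto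
  qed
  ultimately have "card {e \<in> M. e \<inter> fibre v \<noteq> {}} \<le> card N"
    using H.finite_induced_matching by (meson surj_card_le)
  then show ?thesis
    using card_le_induced_matching_number[OF H.pair_graph_axioms N] by linarith
qed

lemma induced_matching_number_corona_le:
  assumes "uedges H \<noteq> {}"
  shows "induced_matching_number (corona G H) \<le> card (pverts G) * induced_matching_number H"
proof -
  obtain M where M: "induced_matching (corona G H) M"
    "card M = induced_matching_number (corona G H)"
    using obtain_maximum_induced_matching[OF C.pair_graph_axioms] .
  let ?F = "\<lambda>v. {e \<in> M. e \<inter> fibre v \<noteq> {}}"
  \<comment> \<open>A base edge lies over both of its ends, so this union need not be disjoint; an
    upper bound by the sum is enough.\<close>
  have "M = (\<Union>v\<in>pverts G. ?F v)"
    using uedge_meets_fibre[OF C.induced_matching_uedge[OF M(1)]] by auto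
  then have "card M \<le> (\<Sum>v\<in>pverts G. card (?F v))"
    using card_UN_le[OF G.pair_finite_verts, of ?F] by simp
  also have "\<dots> \<le> card (pverts G) * induced_matching_number H"
    using sum_bounded_above[of "pverts G" "\<lambda>v. card (?F v)"] card_over_vertex_le[OF M(1) _ assms]
    by simp
  finally show ?thesis using M(2) by simp
qed

text \<open>One optimal matching of \<open>H\<close> can be placed in every copy at once, because
  distinct copies are disjoint and no edge joins them.\<close>

lemma induced_matching_number_corona_ge:
  "card (pverts G) * induced_matching_number H \<le> induced_matching_number (corona G H)"
proof -
  obtain N where N: "induced_matching H N" "card N = induced_matching_number H"
    using obtain_maximum_induced_matching[OF H.pair_graph_axioms] .
  define c :: "'a \<times> 'b set \<Rightarrow> ('a + 'a \<times> 'b) set" where "c = (\<lambda>(v, e). Inr ` ({v} \<times> e))"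
  have edge: "\<exists>x y. (x, y) \<in> parcs H \<and> e = {x, y}" if "e \<in> N" for e
    using H.induced_matching_uedge[OF N(1) that] by (auto simp: uedges_def)
  have "inj_on c (pverts G \<times> N)"
  proof (rule inj_onI)
    fix p q assume *: "p \<in> pverts G \<times> N" "q \<in> pverts G \<times> N" "c p = c q"
    obtain v e w f where pq: "p = (v, e)" "q = (w, f)" by (cases p, cases q)
    have "{v} \<times> e = {w} \<times> f"
      using * pq by (simp add: c_def inj_image_eq_iff)
    \<comment> \<open>With \<open>e\<close> empty the product would forget \<open>v\<close>; a
      nonempty edge lets both factors be recovered.\<close>
    moreover have "e \<noteq> {}" using * pq edge by blast
    ultimately show "p = q" using pq by (auto simp: times_eq_iff)
  qed
  then have "card (c ` (pverts G \<times> N)) = card (pverts G) * induced_matching_number H"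
    by (simp add: card_image card_cartesian_product N(2))
  moreover have "induced_matching (corona G H) (c ` (pverts G \<times> N))"
    unfolding C.induced_matching_iff
  proof (intro conjI ballI impI)
    show "c ` (pverts G \<times> N) \<subseteq> uedges (corona G H)"
    proof
      fix d assume "d \<in> c ` (pverts G \<times> N)"
      then obtain v e where ve: "v \<in> pverts G" "e \<in> N" "d = c (v, e)" by auto
      obtain x y where "(x, y) \<in> parcs H" "e = {x, y}" using edge ve by blast
      then show "d \<in> uedges (corona G H)" using ve by (simp add: c_def C.uedges_iff)
    qed
    fix d d' a b
    assume *: "d \<in> c ` (pverts G \<times> N)" "d' \<in> c ` (pverts G \<times> N)" "d \<noteq> d'" "a \<in> d" "b \<in> d'"
    then obtain v e w f where d: "e \<in> N" "f \<in> N" "d = c (v, e)" "d' = c (w, f)"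
      by blast
    then obtain x y where xy: "a = Inr (v, x)" "b = Inr (w, y)" "x \<in> e" "y \<in> f"
      using * by (auto simp: c_def)
    \<comment> \<open>Either the two edges lie in different copies, or they come from different
      edges of \<open>N\<close>, which are separated in \<open>H\<close>.\<close>
    have "v \<noteq> w \<or> e \<noteq> f" using * d by auto
    then have "v \<noteq> w \<or> x \<noteq> y \<and> (x, y) \<notin> parcs H"
      using H.induced_matching_separated[OF N(1)] d xy by blast
    then show "a \<noteq> b" "(a, b) \<notin> parcs (corona G H)" using xy by auto
  qed
  ultimately show ?thesis
    using card_le_induced_matching_number[OF C.pair_graph_axioms] by metis
qed

lemma induced_matching_number_corona_le_independence_number:
  assumes "uedges H = {}"
  shows "induced_matching_number (corona G H) \<le> independence_number G"
proof -
  obtain M where M: "induced_matching (corona G H) M"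
    "card M = induced_matching_number (corona G H)"
    using obtain_maximum_induced_matching[OF C.pair_graph_axioms] .
  have "\<exists>v\<in>pverts G. Inl v \<in> e" if "e \<in> M" for e
  proof -
    have "e \<in> uedges (corona G H)" using C.induced_matching_uedge M(1) that by blast
    then show ?thesis
      using assms
      by (cases rule: uedges_corona_cases) (auto dest: G.wellformed' simp flip: H.uedges_iff)
  qed
  \<comment> \<open>For a base edge \<open>r\<close> chooses one of two ends; either would do, since
    separation holds for all pairs of endpoints.\<close>
  then obtain r where r: "\<And>e. e \<in> M \<Longrightarrow> r e \<in> pverts G \<and> Inl (r e) \<in> e" by metis
  have sep: "r e \<noteq> r f \<and> (r e, r f) \<notin> parcs G" if "e \<in> M" "f \<in> M" "e \<noteq> f" for e f
    using C.induced_matching_separated[OF M(1) that, of "Inl (r e)" "Inl (r f)"] r that by simp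
  have "independent_set G (r ` M)"
    \<comment> \<open>Independence also quantifies over equal vertices: loop-freeness settles
      \<open>e = f\<close>, and \<open>sep\<close> the rest.\<close>
    unfolding G.independent_set_iff using r sep G.no_loops' by (auto; metis)
  moreover have "inj_on r M" using sep by (meson inj_onI)
  ultimately show ?thesis
    using card_le_independence_number[OF G.pair_graph_axioms] M(2) by (metis card_image)
qed

text \<open>A copy vertex has no neighbours outside its copy except its own base vertex, so two
  spokes could be joined only through their base ends. One fixed \<open>x\<close> serves for all
  copies.\<close>

lemma independence_number_le_induced_matching_number_corona:
  assumes "pverts H \<noteq> {}"
  shows "independence_number G \<le> induced_matching_number (corona G H)"
proof -
  obtain S where S: "independent_set G S" "card S = independence_number G"
    using obtain_maximum_independent_set[OF G.pair_graph_axioms] .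
  obtain x where x: "x \<in> pverts H" using assms by blast
  define s :: "'a \<Rightarrow> ('a + 'a \<times> 'b) set" where "s = (\<lambda>v. {Inl v, Inr (v, x)})"
  have "inj_on s S" by (auto simp: s_def doubleton_eq_iff intro: inj_onI)
  moreover have "induced_matching (corona G H) (s ` S)"
    using S(1) x unfolding C.induced_matching_iff G.independent_set_iff
    by (auto simp: s_def C.uedges_iff)
  ultimately show ?thesis
    using card_le_induced_matching_number[OF C.pair_graph_axioms] S(2) by (metis card_image)
qed

end

theorem corollary6p2:
  fixes G :: "'a pair_pre_digraph" and H :: "'b pair_pre_digraph"
  assumes "pair_graph G" and "pverts G \<noteq> {}"
    and "pair_graph H" and "pverts H \<noteq> {}"
  shows "induced_matching_number (corona G H) =
    (if uedges H \<noteq> {} then card (pverts G) * induced_matching_number H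
     else independence_number G)"
proof -
  interpret corona_graphs G H
    using assms by (simp add: corona_graphs_def)
  show ?thesis
    using induced_matching_number_corona_le induced_matching_number_corona_ge
      induced_matching_number_corona_le_independence_number
      independence_number_le_induced_matching_number_corona[OF assms(4)]
    by (simp add: le_antisym)
qed

end
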